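(* Let $n \geq 6$ be an even integer and suppose that $n$ has an odd prime factor $p$ with $p \leq \lceil \log_2 n \rceil$ such that $2$ is a primitive root modulo $p$. Then $\gamma(KG_n) \leq \frac{n}{p}$.
   Context: For even $n \geq 6$, the Knödel graph $KG_n$ has vertex set $\{0,1,\dots,n-1\}$, and $\{x,y\}$ is an edge if and only if $x + y \equiv 2^t - 1 \pmod n$ for some $t \in \{1,2,\dots,\lfloor \log_2 n\rfloor\}$. A dominating set of a graph $G$ is a set $D$ of vertices such that every vertex is in $D$ or adjacent to a vertex of $D$; $\gamma(G)$ denotes the minimum size of a dominating set. *)

theory Defs
  imports
    Complex_Main
    "HOL-Number_Theory.Number_Theory"
    "Graph_Theory.Graph_Theory"
begin

text \<open>
  Undirected simple graphs are symmetric loop-free digraphs, so adjacency of \<open>u\<close> and \<open>v\<close>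
  is the arc relation \<open>u \<rightarrow>\<^bsub>G\<^esub> v\<close>.
\<close>

definition dominating_set :: "('a, 'b) pre_digraph \<Rightarrow> 'a set \<Rightarrow> bool" where
  "dominating_set G D \<longleftrightarrow>
     D \<subseteq> verts G \<and> (\<forall>v \<in> verts G. v \<in> D \<or> (\<exists>u \<in> D. u \<rightarrow>\<^bsub>G\<^esub> v))"

text \<open>
  Only meaningful for finite graphs: there the vertex set itself is a dominating set, so that
  the minimum is taken over a finite nonempty set.
\<close>

definition domination_number :: "('a, 'b) pre_digraph \<Rightarrow> nat" where
  "domination_number G = Min {card D |D. dominating_set G D}"

lemma (in fin_digraph) domination_number_finite_nonempty:
  "finite {card D |D. dominating_set G D}" "{card D |D. dominating_set G D} \<noteq> {}"
proof -
  have "{card D |D. dominating_set G D} \<subseteq> card ` Pow (verts G)"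
    by (auto simp: dominating_set_def)
  then show "finite {card D |D. dominating_set G D}"
    by (rule finite_subset) simp
  have "dominating_set G (verts G)"
    by (auto simp: dominating_set_def)
  then show "{card D |D. dominating_set G D} \<noteq> {}"
    by blast
qed

definition knodel_graph :: "nat \<Rightarrow> nat pair_pre_digraph" where
  "knodel_graph n =
     \<lparr> pverts = {0..<n},
       parcs = {(x, y). x \<in> {0..<n} \<and> y \<in> {0..<n} \<and>
         (\<exists>t::nat. 1 \<le> t \<and> int t \<le> \<lfloor>log 2 (real n)\<rfloor> \<and> [x + y = 2 ^ t - 1] (mod n))} \<rparr>"

text \<open>
  No inequality of \<open>x\<close> and \<open>y\<close> has to be imposed above: for even \<open>n\<close> the sum \<open>x + y\<close> of two
  adjacent vertices is odd.
\<close>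

lemma pair_graph_knodel_graph:
  assumes "even n"
  shows "pair_graph (knodel_graph n)"
proof -
  have loopfree: False if "1 \<le> t" "[x + x = 2 ^ t - 1] (mod n)" for x t :: nat
  proof -
    have "[x + x = 2 ^ t - 1] (mod 2)"
      using that(2) assms by (rule cong_dvd_modulus_nat)
    then have "even (x + x) \<longleftrightarrow> even (2 ^ t - 1 :: nat)"
      by (metis cong_dvd_iff cong_sym dvd_refl)
    with that(1) show False
      by simp
  qed
  show ?thesis
  proof
    show "finite (parcs (knodel_graph n))"
      by (rule finite_subset[of _ "{0..<n} \<times> {0..<n}"]) (auto simp: knodel_graph_def)
    show "fst e \<noteq> snd e" if "e \<in> parcs (knodel_graph n)" for e
      using that loopfree by (auto simp: knodel_graph_def)
    show "symmetric (knodel_graph n)"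
      by (auto simp: symmetric_def sym_def knodel_graph_def add.commute)
  qed (auto simp: knodel_graph_def)
qed

end

theory Submission
  imports Defs
begin

text \<open>
  Adjacency of \<open>u\<close> and \<open>v\<close> modulo \<open>n\<close> forces \<open>u + v + 1\<close> to be a power of \<open>2\<close> modulo \<open>p\<close>. The exponents
  \<open>1, \<dots>, p - 1\<close> are available because \<open>p - 1 \<le> \<lfloor>log\<^sub>2 n\<rfloor>\<close>, and they yield every nonzero residue
  because \<open>2\<close> is a primitive root. Hence the residue class of \<open>c\<close> dominates every vertex \<open>v\<close> with
  \<open>v \<noteq> -1 - c\<close> modulo \<open>p\<close>; for \<open>c = (p - 1) / 2\<close> the exceptional class is the class of \<open>c\<close> itself.
\<close>

lemma card_residue_class:
  fixes n p c :: nat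
  assumes "p dvd n" "c < p"
  shows "card {x \<in> {0..<n}. x mod p = c} = n div p"
proof -
  from assms(1) obtain m where m: "n = p * m" by blast
  have "{x \<in> {0..<n}. x mod p = c} = (\<lambda>k. p * k + c) ` {0..<m}" (is "?A = ?B")
  proof
    show "?A \<subseteq> ?B"
    proof
      fix x assume x: "x \<in> ?A"
      then have "x = p * (x div p) + c" by (auto simp: mult_div_mod_eq)
      moreover have "x div p < m"
        using x m by (simp add: less_mult_imp_div_less mult.commute)
      ultimately show "x \<in> ?B" by auto
    qed
    show "?B \<subseteq> ?A"
    proof
      fix x assume "x \<in> ?B"
      then obtain k where k: "k < m" "x = p * k + c" by auto
      have "x < p * Suc k" using k assms(2) by simp
      also have "\<dots> \<le> n" using k(1) m by (simp only: mult_le_mono2 Suc_leI)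
      finally show "x \<in> ?A" using k assms(2) by simp
    qed
  qed
  moreover have "inj_on (\<lambda>k. p * k + c) {0..<m}"
    using assms(2) by (auto simp: inj_on_def)
  ultimately show ?thesis
    using m assms(2) by (simp add: card_image)
qed

text \<open>The generator property yields exponents from \<open>0\<close> to \<open>p - 2\<close>,
  but edges require \<open>t\<close> \<ge> 1. By Fermat, exponent \<open>0\<close> can be traded for
  \<open>p - 1\<close>.\<close>

lemma primroot_power_cong:
  fixes p g a :: nat
  assumes "prime p" "residue_primroot p g" "\<not> p dvd a"
  obtains t where "1 \<le> t" "t \<le> p - 1" "[g ^ t = a] (mod p)"
proof -
  have p: "1 < p" using assms(1) by (rule prime_gt_1_nat)
  have "a mod p \<in> totatives p"
    using assms(1,3) p
    by (auto simp: totatives_prime mod_greater_zero_iff_not_dvd)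
  then obtain s where s: "s < totient p" "a mod p = g ^ s mod p"
    using residue_primroot_is_generator[OF p assms(2)] by (auto simp: bij_betw_def)
  have cop: "coprime p g" using assms(2) by (simp add: residue_primroot_def)
  show thesis
  proof (cases "s = 0")
    case True
    have "[g ^ totient p = 1] (mod p)"
      using cop by (intro euler_theorem) (simp add: coprime_commute)
    then have "[g ^ (p - 1) = a] (mod p)"
      using s True assms(1) by (simp add: cong_def totient_prime)
    then show thesis using p by (intro that[of "p - 1"]) auto
  next
    case False
    then show thesis using s assms(1) by (intro that[of s]) (auto simp: cong_def totient_prime)
  qed
qed

lemma dominating_set_residue_class:
  fixes n p :: nat
  assumes "prime p" "odd p" "p dvd n"
    and "int p \<le> \<lceil>log 2 (real n)\<rceil>"
    and "residue_primroot p 2"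
  shows "dominating_set (knodel_graph n) {x \<in> {0..<n}. x mod p = (p - 1) div 2}"
    (is "dominating_set _ ?D")
  unfolding dominating_set_def
proof (intro conjI ballI)
  define c where "c = (p - 1) div 2"
  have c: "p = 2 * c + 1" using assms(2) by (auto simp: c_def elim: oddE)
  show "?D \<subseteq> verts (with_proj (knodel_graph n))" by (auto simp: knodel_graph_def)
  fix v assume "v \<in> verts (with_proj (knodel_graph n))"
  then have v: "v < n" by (simp add: knodel_graph_def)
  show "v \<in> ?D \<or> (\<exists>u\<in>?D. u \<rightarrow>\<^bsub>with_proj (knodel_graph n)\<^esub> v)"
  \<comment> \<open>The excluded residue is the one where \<open>u + v + 1\<close> would be
    \<open>0\<close> modulo \<open>p\<close>, which no power of \<open>2\<close> attains.\<close>
  proof (cases "p dvd v + c + 1")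
    case True
    have "[v + (c + 1) = c + (c + 1)] (mod p)"
    proof -
      have "c + (c + 1) = p" using c by simp
      then show ?thesis using True by (simp only: cong_def mod_self add.assoc mod_eq_0_iff_dvd)
    qed
    then have "[v = c] (mod p)" by (simp only: cong_add_rcancel_nat)
    then have "v mod p = c" using c by (simp add: cong_def)
    then show ?thesis using v by (simp add: c_def)
  next
    case False
    obtain t where t: "1 \<le> t" "t \<le> p - 1" "[2 ^ t = v + c + 1] (mod p)"
      using primroot_power_cong[OF assms(1,5) False] .
    \<comment> \<open>The neighbour of \<open>v\<close> along \<open>t\<close>; \<open>n - v\<close>
      stands for \<open>-v\<close>, so that the subtraction on naturals does not truncate.\<close>
    define u where "u = (2 ^ t - 1 + (n - v)) mod n"
    have "[u + v = 2 ^ t - 1 + (n - v) + v] (mod n)"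
      unfolding u_def by (simp add: cong_def mod_add_left_eq)
    also have "2 ^ t - 1 + (n - v) + v = 2 ^ t - 1 + n" using v by simp
    also have "[\<dots> = 2 ^ t - 1] (mod n)" by (simp only: cong_def mod_add_self2)
    finally have uv: "[u + v = 2 ^ t - 1] (mod n)" .
    \<comment> \<open>Since \<open>p\<close> divides \<open>n\<close>, the edge congruence descends
      to \<open>p\<close>; cancelling \<open>v + 1\<close> then puts \<open>u\<close> in the class
      of \<open>c\<close>.\<close>
    have "[u + v + 1 = 2 ^ t - 1 + 1] (mod p)"
      using cong_dvd_modulus_nat[OF uv assms(3)] by (intro cong_add cong_refl)
    also have "2 ^ t - 1 + 1 = (2 ^ t :: nat)" by simp
    also note t(3)
    finally have "[u + (v + 1) = c + (v + 1)] (mod p)" by (simp add: ac_simps)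
    then have "[u = c] (mod p)" by (simp only: cong_add_rcancel_nat)
    then have "u mod p = c" using c by (simp add: cong_def)
    moreover have u: "u < n" using v unfolding u_def by simp
    ultimately have "u \<in> ?D" by (simp add: c_def)
    \<comment> \<open>A ceiling exceeds the floor by at most 1, and \<open>t\<close> \<le>
      \<open>p - 1\<close> absorbs this gap.\<close>
    moreover have "int t \<le> \<lfloor>log 2 (real n)\<rfloor>"
      using t(1,2) assms(4) by linarith
    then have "u \<rightarrow>\<^bsub>with_proj (knodel_graph n)\<^esub> v"
      using u v uv t(1) by (auto simp: knodel_graph_def)
    ultimately show ?thesis by blast
  qed
qed

theorem theorem6:
  fixes n p :: nat
  assumes "n \<ge> 6" and "even n"
    and "prime p" and "odd p" and "p dvd n"
    and "int p \<le> \<lceil>log 2 (real n)\<rceil>"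
    and "residue_primroot p 2"
  shows "real (domination_number (knodel_graph n)) \<le> real n / real p"
proof -
  \<comment> \<open>Supplies the finiteness that \<open>Min_le\<close> requires.\<close>
  interpret pair_graph "knodel_graph n"
    using assms(2) by (rule pair_graph_knodel_graph)
  let ?D = "{x \<in> {0..<n}. x mod p = (p - 1) div 2}"
  have "dominating_set (knodel_graph n) ?D"
    using assms by (intro dominating_set_residue_class)
  then have "domination_number (knodel_graph n) \<le> card ?D"
    unfolding domination_number_def
    by (intro Min_le domination_number_finite_nonempty) auto
  also have "card ?D = n div p"
    using assms(5) prime_gt_0_nat[OF assms(3)] by (intro card_residue_class) auto
  finally show ?thesis
    using assms(5) by (metis of_nat_le_iff real_of_nat_div)
qed

end
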